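(* Let $(S,\Sigma,\mu)$ be a $\sigma$-finite measure space, with $\mu$ a complete positive measure, having at least two disjoint measurable sets of finite positive measure. Let $X$ be a non-zero real Banach space such that $X^*$ has the wide Radon-Nikodym property with respect to $\mu$. Then the space $L^1(\mu,X)$ does not have Property P.
   Context: $L^1(\mu,X)$ is the Lebesgue-Bochner space of (a.e.-equivalence classes of) strongly measurable functions $f:S\to X$ (a.e. pointwise limits of simple measurable functions) with $\|f\|=\int_S\|f(s)\|\,d\mu(s)<\infty$. Wide Radon-Nikodym property: a Banach space $Y$ has it with respect to the $\sigma$-finite measure $\mu$ if every countably additive vector measure $\nu:\Sigma\to Y$ of bounded variation that is absolutely continuous with respect to $\mu$ (i.e. $\mu(E)=0$ implies $\nu(E)=0$) has a Bochner integrable density, i.e. there is $h\in L^1(\mu,Y)$ with $\nu(E)=\int_E h\,d\mu$ for all $E\in\Sigma$. Let $Y$ be a normed space over $\mathbb{F}$ ($\mathbb{R}$ or $\mathbb{C}$). For $x,y\in Y$, $x$ is Birkhoff-James orthogonal to $y$, written $x\perp_{BJ}y$, if $\|x+\alpha y\|\ge\|x\|$ for all $\alpha\in\mathbb{F}$. For $\epsilon\in(0,1)$, $x$ is $\epsilon$-approximate Birkhoff-James orthogonal to $y$, written $x\perp^{\epsilon}_{BJ}y$, if $\|x+\alpha y\|^2\ge\|x\|^2-2\epsilon\|x\|\|\alpha y\|$ for all $\alpha\in\mathbb{F}$. A Banach space $Y$ over $\mathbb{F}$ has Property P if there exists $\epsilon\in(0,1)$ such that every bounded linear operator $T:Y\to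 Y$ satisfying "for all $x,y\in Y$, $x\perp_{BJ}y$ implies $T(x)\perp^{\epsilon}_{BJ}T(y)$" is a scalar multiple of an isometry (that is, there is $c\ge 0$ with $\|T(x)\|=c\|x\|$ for all $x\in Y$). *)

theory Defs
  imports "HOL-Analysis.Analysis"
begin

(* The library's L1 theory (borel measurability, has_bochner_integral, integrable) is restricted
   to second countable, i.e. separable, target spaces.  Neither X nor its dual is assumed
   separable here, so strong measurability and the Bochner integral are defined for arbitrary
   normed targets, on top of the library's simple functions. *)

definition strongly_measurable :: "'s measure \<Rightarrow> ('s \<Rightarrow> 'x::real_normed_vector) \<Rightarrow> bool" where
  "strongly_measurable M f \<longleftrightarrow>
     (\<exists>u :: nat \<Rightarrow> 's \<Rightarrow> 'x. (\<forall>i. simple_function M (u i)) \<and>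
        (AE s in M. (\<lambda>i. u i s) \<longlonglongrightarrow> f s))"

definition L1_functions :: "'s measure \<Rightarrow> ('s \<Rightarrow> 'x::real_normed_vector) set" where
  "L1_functions M = {f. strongly_measurable M f \<and> integrable M (\<lambda>s. norm (f s))}"

definition has_strong_bochner_integral ::
    "'s measure \<Rightarrow> ('s \<Rightarrow> 'x::real_normed_vector) \<Rightarrow> 'x \<Rightarrow> bool" where
  "has_strong_bochner_integral M f x \<longleftrightarrow> strongly_measurable M f \<and>
     (\<exists>u. (\<forall>i. Bochner_Integration.simple_bochner_integrable M (u i)) \<and>
        (\<lambda>i. \<integral>\<^sup>+s. ennreal (norm (f s - u i s)) \<partial>M) \<longlonglongrightarrow> 0 \<and>
        (\<lambda>i. Bochner_Integration.simple_bochner_integral M (u i)) \<longlonglongrightarrow> x)"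


(* Vector measures on the sigma-algebra of M; only the values on sets M matter. *)

definition countably_additive_vm ::
    "'s measure \<Rightarrow> ('s set \<Rightarrow> 'y::real_normed_vector) \<Rightarrow> bool" where
  "countably_additive_vm M \<nu> \<longleftrightarrow>
     (\<forall>E :: nat \<Rightarrow> 's set. range E \<subseteq> sets M \<and> disjoint_family E
        \<longrightarrow> (\<lambda>n. \<nu> (E n)) sums \<nu> (\<Union>n. E n))"

definition bounded_variation_vm ::
    "'s measure \<Rightarrow> ('s set \<Rightarrow> 'y::real_normed_vector) \<Rightarrow> bool" where
  "bounded_variation_vm M \<nu> \<longleftrightarrow>
     (\<exists>K. \<forall>P. finite P \<and> P \<subseteq> sets M \<and> partition_on (space M) P
        \<longrightarrow> (\<Sum>E\<in>P. norm (\<nu> E)) \<le> K)"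

definition absolutely_continuous_vm ::
    "'s measure \<Rightarrow> ('s set \<Rightarrow> 'y::real_normed_vector) \<Rightarrow> bool" where
  "absolutely_continuous_vm M \<nu> \<longleftrightarrow> (\<forall>E\<in>sets M. emeasure M E = 0 \<longrightarrow> \<nu> E = 0)"

definition wide_RNP :: "'s measure \<Rightarrow> 'y::banach itself \<Rightarrow> bool" where
  "wide_RNP M Y \<longleftrightarrow>
     (\<forall>\<nu> :: 's set \<Rightarrow> 'y.
        countably_additive_vm M \<nu> \<and> bounded_variation_vm M \<nu> \<and> absolutely_continuous_vm M \<nu>
        \<longrightarrow> (\<exists>h\<in>L1_functions M. \<forall>E\<in>sets M.
               has_strong_bochner_integral M (\<lambda>s. indicator E s *\<^sub>R h s) (\<nu> E)))"


(* The space L1(M, X) depends on the term M, so it cannot be an instance of a type class;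
   real normed spaces are therefore treated as structures with an explicit carrier. *)

record 'v normed_structure =
  ns_carrier :: "'v set"
  ns_add :: "'v \<Rightarrow> 'v \<Rightarrow> 'v"
  ns_scale :: "real \<Rightarrow> 'v \<Rightarrow> 'v"
  ns_norm :: "'v \<Rightarrow> real"

definition BJ_orthogonal :: "'v normed_structure \<Rightarrow> 'v \<Rightarrow> 'v \<Rightarrow> bool" where
  "BJ_orthogonal Y x y \<longleftrightarrow>
     (\<forall>\<alpha>::real. ns_norm Y (ns_add Y x (ns_scale Y \<alpha> y)) \<ge> ns_norm Y x)"

definition approx_BJ_orthogonal ::
    "real \<Rightarrow> 'v normed_structure \<Rightarrow> 'v \<Rightarrow> 'v \<Rightarrow> bool" where
  "approx_BJ_orthogonal \<epsilon> Y x y \<longleftrightarrow>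
     (\<forall>\<alpha>::real. (ns_norm Y (ns_add Y x (ns_scale Y \<alpha> y)))\<^sup>2
        \<ge> (ns_norm Y x)\<^sup>2 - 2 * \<epsilon> * ns_norm Y x * ns_norm Y (ns_scale Y \<alpha> y))"

definition bounded_linear_operator :: "'v normed_structure \<Rightarrow> ('v \<Rightarrow> 'v) \<Rightarrow> bool" where
  "bounded_linear_operator Y T \<longleftrightarrow>
     (\<forall>x\<in>ns_carrier Y. T x \<in> ns_carrier Y) \<and>
     (\<forall>x\<in>ns_carrier Y. \<forall>y\<in>ns_carrier Y. T (ns_add Y x y) = ns_add Y (T x) (T y)) \<and>
     (\<forall>a::real. \<forall>x\<in>ns_carrier Y. T (ns_scale Y a x) = ns_scale Y a (T x)) \<and>
     (\<exists>K. \<forall>x\<in>ns_carrier Y. ns_norm Y (T x) \<le> K * ns_norm Y x)"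

definition property_P :: "'v normed_structure \<Rightarrow> bool" where
  "property_P Y \<longleftrightarrow>
     (\<exists>\<epsilon>. 0 < \<epsilon> \<and> \<epsilon> < 1 \<and>
        (\<forall>T. bounded_linear_operator Y T \<and>
             (\<forall>x\<in>ns_carrier Y. \<forall>y\<in>ns_carrier Y.
                BJ_orthogonal Y x y \<longrightarrow> approx_BJ_orthogonal \<epsilon> Y (T x) (T y))
           \<longrightarrow> (\<exists>c\<ge>0. \<forall>x\<in>ns_carrier Y. ns_norm Y (T x) = c * ns_norm Y x)))"


definition L1_rel :: "'s measure \<Rightarrow> (('s \<Rightarrow> 'x::real_normed_vector) \<times> ('s \<Rightarrow> 'x)) set" where
  "L1_rel M = {(f, g). f \<in> L1_functions M \<and> g \<in> L1_functions M \<and> (AE s in M. f s = g s)}"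

(* The operations are those on representatives: the unions below run over sets that do not
   depend on the chosen representatives, and the norm is constant on each class. *)
definition L1_space :: "'s measure \<Rightarrow> ('s \<Rightarrow> 'x::real_normed_vector) set normed_structure" where
  "L1_space M =
     \<lparr> ns_carrier = L1_functions M // L1_rel M,
       ns_add = (\<lambda>A B. \<Union>f\<in>A. \<Union>g\<in>B. L1_rel M `` {\<lambda>s. f s + g s}),
       ns_scale = (\<lambda>a A. \<Union>f\<in>A. L1_rel M `` {\<lambda>s. a *\<^sub>R f s}),
       ns_norm = (\<lambda>A. the_elem ((\<lambda>f. LINT s|M. norm (f s)) ` A)) \<rparr>"

end

theory Submission
  imports Defs
begin

text \<open>
  Every \<open>\<epsilon> \<in> (0,1)\<close> is defeated by a multiplication operator \<open>T f = w f\<close>, where the weight \<open>w\<close>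
  equals \<open>1 + \<epsilon>\<close> on one of the two disjoint sets of finite positive measure and \<open>1\<close> elsewhere.
  Such a \<open>T\<close> scales the functions supported on the first set by \<open>1 + \<epsilon>\<close> and those supported on
  the second set by \<open>1\<close>, so it is not a multiple of an isometry.

  It remains to see that \<open>T\<close> maps Birkhoff-James orthogonal pairs to \<open>\<epsilon>\<close>-approximately orthogonal
  ones. Because the \<open>L\<^sup>1\<close> norm is an integral of pointwise norms, multiplication by \<open>w\<close> can be
  compared with the identity point by point: with norms taken in \<open>X\<close>,
  \<open>w (|f + \<alpha> g| - |f|) \<ge> (|f + \<alpha> g| - |f|) - (w - 1) |\<alpha> g|\<close>,
  since \<open>w \<ge> 1\<close> and \<open>|f + \<alpha> g| - |f| \<ge> - |\<alpha> g|\<close>. Integrate this. Orthogonality of \<open>f\<close> and \<open>g\<close> says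
  that the first term on the right has non-negative integral, and the second is small because
  \<open>w - 1 \<le> \<epsilon> \<le> \<epsilon> w\<close>. The outcome (\<open>weighted_norm_integral_lower_bound\<close>) is
  \<open>\<parallel>T f + \<alpha> T g\<parallel> \<ge> \<parallel>T f\<parallel> - \<epsilon> \<parallel>\<alpha> T g\<parallel>\<close>, and squaring it (\<open>squared_lower_bound\<close>) gives approximate
  orthogonality.
\<close>

section \<open>Strongly measurable functions\<close>

lemma strongly_measurable_compose2:
  fixes h :: "'x::real_normed_vector \<Rightarrow> 'y::real_normed_vector \<Rightarrow> 'z::real_normed_vector"
  assumes f: "strongly_measurable M f" and g: "strongly_measurable M g"
    and h: "continuous_on UNIV (\<lambda>p. h (fst p) (snd p))"
  shows "strongly_measurable M (\<lambda>s. h (f s) (g s))"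
proof -
  obtain u where u: "\<And>i. simple_function M (u i)" "AE s in M. (\<lambda>i. u i s) \<longlonglongrightarrow> f s"
    using f unfolding strongly_measurable_def by blast
  obtain v where v: "\<And>i. simple_function M (v i)" "AE s in M. (\<lambda>i. v i s) \<longlonglongrightarrow> g s"
    using g unfolding strongly_measurable_def by blast
  have "AE s in M. (\<lambda>i. h (u i s) (v i s)) \<longlonglongrightarrow> h (f s) (g s)"
    using u(2) v(2)
  proof eventually_elim
    case (elim s)
    have "(\<lambda>i. (\<lambda>p. h (fst p) (snd p)) (u i s, v i s)) \<longlonglongrightarrow> (\<lambda>p. h (fst p) (snd p)) (f s, g s)"
      by (rule continuous_on_tendsto_compose[OF h]) (use elim in \<open>auto intro: tendsto_Pair\<close>)
    then show ?case by simp
  qed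
  moreover have "simple_function M (\<lambda>s. h (u i s) (v i s))" for i
    by (rule simple_function_compose2[OF u(1) v(1)])
  ultimately show ?thesis
    unfolding strongly_measurable_def by (intro exI[of _ "\<lambda>i s. h (u i s) (v i s)"]) simp
qed

lemma strongly_measurable_simple:
  "simple_function M f \<Longrightarrow> strongly_measurable M f"
  unfolding strongly_measurable_def by (intro exI[of _ "\<lambda>_. f"]) simp

lemma strongly_measurable_add:
  "strongly_measurable M f \<Longrightarrow> strongly_measurable M g \<Longrightarrow> strongly_measurable M (\<lambda>s. f s + g s)"
  by (rule strongly_measurable_compose2) (auto intro!: continuous_intros)

lemma strongly_measurable_scaleR:
  "strongly_measurable M w \<Longrightarrow> strongly_measurable M f \<Longrightarrow> strongly_measurable M (\<lambda>s. w s *\<^sub>R f s)"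
  by (rule strongly_measurable_compose2) (auto intro!: continuous_intros)

lemma (in complete_measure) borel_measurable_AE_cong:
  assumes g: "g \<in> borel_measurable M" and ae: "AE s in M. g s = f s"
  shows "f \<in> borel_measurable M"
proof (rule measurableI)
  fix A :: "'b set" assume A: "A \<in> sets borel"
  show "f -` A \<inter> space M \<in> sets M"
  proof (rule in_sets_AE)
    show "g -` A \<inter> space M \<in> sets M"
      using g A by (rule measurable_sets)
    show "AE s in M. (s \<in> g -` A \<inter> space M) = (s \<in> f -` A \<inter> space M)"
      using ae by eventually_elim auto
  qed auto
qed simp

text \<open>
  A strongly measurable function is only an a.e. limit of simple functions; completeness makes the
  exceptional null set harmless.
\<close>

lemma (in complete_measure) borel_measurable_norm_strongly_measurable:
  assumes "strongly_measurable M f"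
  shows "(\<lambda>s. norm (f s)) \<in> borel_measurable M"
proof -
  obtain u where u: "\<And>i. simple_function M (u i)" and lim: "AE s in M. (\<lambda>i. u i s) \<longlonglongrightarrow> f s"
    using assms unfolding strongly_measurable_def by blast
  have meas: "(\<lambda>s. norm (u i s)) \<in> borel_measurable M" for i
    by (rule borel_measurable_simple_function) (rule simple_function_compose1[OF u])
  have "AE s in M. lim (\<lambda>i. norm (u i s)) = norm (f s)"
    using lim by eventually_elim (auto intro!: limI tendsto_norm)
  then show ?thesis
    by (rule borel_measurable_AE_cong[OF borel_measurable_lim_metric[OF meas]])
qed

section \<open>Integrable functions and their classes\<close>

lemma L1_functions_integrable_norm:
  "f \<in> L1_functions M \<Longrightarrow> integrable M (\<lambda>s. norm (f s))"
  by (simp add: L1_functions_def)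

lemma (in complete_measure) L1_functions_add:
  assumes f: "f \<in> L1_functions M" and g: "g \<in> L1_functions M"
  shows "(\<lambda>s. f s + g s) \<in> L1_functions M"
proof -
  have sm: "strongly_measurable M (\<lambda>s. f s + g s)"
    using f g by (auto simp: L1_functions_def intro: strongly_measurable_add)
  have "integrable M (\<lambda>s. norm (f s) + norm (g s))"
    using f g by (simp add: L1_functions_def)
  then have "integrable M (\<lambda>s. norm (f s + g s))"
    by (rule Bochner_Integration.integrable_bound)
      (auto simp: borel_measurable_norm_strongly_measurable[OF sm] intro: order_trans[OF norm_triangle_ineq])
  with sm show ?thesis by (simp add: L1_functions_def)
qed

lemma (in complete_measure) L1_functions_bounded_weight:
  assumes w: "simple_function M w" and bound: "\<And>s. \<bar>w s\<bar> \<le> K" and f: "f \<in> L1_functions M"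
  shows "(\<lambda>s. w s *\<^sub>R f s) \<in> L1_functions M"
proof -
  have sm: "strongly_measurable M (\<lambda>s. w s *\<^sub>R f s)"
    using f by (auto simp: L1_functions_def
        intro: strongly_measurable_scaleR strongly_measurable_simple[OF w])
  have "integrable M (\<lambda>s. K * norm (f s))"
    using f by (simp add: L1_functions_def)
  then have "integrable M (\<lambda>s. norm (w s *\<^sub>R f s))"
  proof (rule Bochner_Integration.integrable_bound)
    show "AE s in M. norm (norm (w s *\<^sub>R f s)) \<le> norm (K * norm (f s))"
      using bound by (auto simp: abs_mult intro!: mult_right_mono order_trans[OF bound])
  qed (rule borel_measurable_norm_strongly_measurable[OF sm])
  with sm show ?thesis by (simp add: L1_functions_def)
qed

lemma (in complete_measure) L1_functions_scale:
  "f \<in> L1_functions M \<Longrightarrow> (\<lambda>s. a *\<^sub>R f s) \<in> L1_functions M"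
  by (rule L1_functions_bounded_weight[where K = "\<bar>a\<bar>" and w = "\<lambda>_. a"]) auto

lemma L1_functions_indicator:
  assumes "A \<in> sets M" "emeasure M A < \<infinity>"
  shows "(\<lambda>s. indicator A s *\<^sub>R x) \<in> L1_functions M"
proof -
  have "simple_function M (\<lambda>s. indicator A s *\<^sub>R x)"
    by (rule simple_function_compose1[OF simple_function_indicator[OF assms(1)]])
  moreover have "integrable M (\<lambda>s. norm (indicator A s *\<^sub>R x))"
    using assms by auto
  ultimately show ?thesis
    by (simp add: L1_functions_def strongly_measurable_simple)
qed

text \<open>
  The next lemmas reduce every computation in \<open>L1_space\<close> to one with representatives.
\<close>

abbreviation L1_class :: "'s measure \<Rightarrow> ('s \<Rightarrow> 'x::real_normed_vector) \<Rightarrow> ('s \<Rightarrow> 'x) set" where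
  "L1_class M f \<equiv> L1_rel M `` {f}"

lemma equiv_L1_rel:
  "equiv (L1_functions M :: ('s \<Rightarrow> 'x::real_normed_vector) set) (L1_rel M)"
proof (rule equivI)
  show "L1_rel M \<subseteq> L1_functions M \<times> L1_functions M"
    by (auto simp: L1_rel_def)
  show "refl_on (L1_functions M) (L1_rel M)"
    by (auto simp: refl_on_def L1_rel_def)
  show "sym (L1_rel M)"
    by (auto simp: sym_def L1_rel_def elim: eventually_mono)
  show "trans (L1_rel M :: (('s \<Rightarrow> 'x) \<times> _) set)"
  proof (rule transI)
    fix f g h :: "'s \<Rightarrow> 'x" assume "(f, g) \<in> L1_rel M" "(g, h) \<in> L1_rel M"
    moreover from this have "AE s in M. f s = g s" "AE s in M. g s = h s"
      by (auto simp: L1_rel_def)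
    then have "AE s in M. f s = h s"
      by eventually_elim simp
    ultimately show "(f, h) \<in> L1_rel M"
      by (simp add: L1_rel_def)
  qed
qed

lemma L1_class_eqI:
  "f \<in> L1_functions M \<Longrightarrow> g \<in> L1_functions M \<Longrightarrow> AE s in M. f s = g s \<Longrightarrow> L1_class M f = L1_class M g"
  by (rule equiv_class_eq[OF equiv_L1_rel]) (simp add: L1_rel_def)

lemma L1_class_in_carrier:
  "f \<in> L1_functions M \<Longrightarrow> L1_class M f \<in> ns_carrier (L1_space M)"
  by (simp add: L1_space_def quotientI)

lemma L1_carrierE:
  assumes "F \<in> ns_carrier (L1_space M)"
  obtains f where "f \<in> L1_functions M" "F = L1_class M f"
  using assms by (auto simp: L1_space_def elim: quotientE)

lemma (in complete_measure) L1_space_add_class: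
  fixes f g :: "'a \<Rightarrow> 'x::real_normed_vector"
  assumes "f \<in> L1_functions M" "g \<in> L1_functions M"
  shows "ns_add (L1_space M) (L1_class M f) (L1_class M g) = L1_class M (\<lambda>s. f s + g s)"
proof -
  have "congruent2 (L1_rel M) (L1_rel M) (\<lambda>(f :: 'a \<Rightarrow> 'x) g. L1_class M (\<lambda>s. f s + g s))"
  proof (rule congruent2I')
    fix f f' g g' :: "'a \<Rightarrow> 'x" assume "(f, f') \<in> L1_rel M" "(g, g') \<in> L1_rel M"
    then have L1: "f \<in> L1_functions M" "f' \<in> L1_functions M" "g \<in> L1_functions M" "g' \<in> L1_functions M"
      and "AE s in M. f s = f' s" "AE s in M. g s = g' s"
      by (auto simp: L1_rel_def)
    from this(5,6) have "AE s in M. f s + g s = f' s + g' s"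
      by eventually_elim simp
    with L1 show "L1_class M (\<lambda>s. f s + g s) = L1_class M (\<lambda>s. f' s + g' s)"
      by (intro L1_class_eqI L1_functions_add)
  qed
  from UN_equiv_class2[OF equiv_L1_rel equiv_L1_rel this assms]
  show ?thesis by (simp add: L1_space_def)
qed

lemma (in complete_measure) UN_L1_class_bounded_weight:
  assumes w: "simple_function M w" and bound: "\<And>s. \<bar>w s\<bar> \<le> K" and f: "f \<in> L1_functions M"
  shows "(\<Union>f'\<in>L1_class M f. L1_class M (\<lambda>s. w s *\<^sub>R f' s)) = L1_class M (\<lambda>s. w s *\<^sub>R f s)"
proof -
  have "(\<lambda>f'. L1_class M (\<lambda>s. w s *\<^sub>R f' s)) respects L1_rel M"
    by (rule congruentI, rule L1_class_eqI)
      (auto simp: L1_rel_def intro: L1_functions_bounded_weight[OF w bound] elim: eventually_mono)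
  from UN_equiv_class[OF equiv_L1_rel this f] show ?thesis .
qed

lemma (in complete_measure) L1_space_scale_class:
  "f \<in> L1_functions M \<Longrightarrow> ns_scale (L1_space M) a (L1_class M f) = L1_class M (\<lambda>s. a *\<^sub>R f s)"
  using UN_L1_class_bounded_weight[where K = "\<bar>a\<bar>" and w = "\<lambda>_. a"] by (simp add: L1_space_def)

lemma L1_space_norm_class:
  assumes f: "f \<in> L1_functions M"
  shows "ns_norm (L1_space M) (L1_class M f) = (LINT s|M. norm (f s))"
proof -
  have "(LINT s|M. norm (g s)) = (LINT s|M. norm (f s))" if "g \<in> L1_class M f" for g
  proof (rule integral_cong_AE)
    show "AE s in M. norm (g s) = norm (f s)"
      using that by (auto simp: L1_rel_def elim: eventually_mono)
  qed (use that in \<open>auto simp: L1_rel_def L1_functions_def\<close>)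
  moreover have "f \<in> L1_class M f"
    using f equiv_class_self[OF equiv_L1_rel] by blast
  ultimately have "(\<lambda>g. LINT s|M. norm (g s)) ` L1_class M f = {LINT s|M. norm (f s)}"
    by blast
  then show ?thesis by (simp add: L1_space_def)
qed

section \<open>Multiplication by a weight close to one\<close>

text \<open>
  Where adding \<open>g\<close> enlarges \<open>f\<close>, the weight only helps; where it makes \<open>f\<close> smaller, it does so by
  at most \<open>|g|\<close>, and the weight amplifies this loss by at most \<open>\<epsilon> |g| \<le> \<epsilon> w |g|\<close>. Orthogonality is
  used for one scalar at a time, so the lemma is applied with \<open>\<alpha> g\<close> in the place of \<open>g\<close>.
\<close>

lemma (in complete_measure) weighted_norm_integral_lower_bound:
  assumes w: "simple_function M w" "\<And>s. 1 \<le> w s" "\<And>s. w s \<le> 1 + \<epsilon>"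
    and f: "f \<in> L1_functions M" and g: "g \<in> L1_functions M"
    and le: "(LINT s|M. norm (f s)) \<le> (LINT s|M. norm (f s + g s))"
  shows "(LINT s|M. norm (w s *\<^sub>R f s)) - \<epsilon> * (LINT s|M. norm (w s *\<^sub>R g s))
           \<le> (LINT s|M. norm (w s *\<^sub>R f s + w s *\<^sub>R g s))"
proof -
  have abs_w: "\<bar>w s\<bar> \<le> 1 + \<epsilon>" for s
    using w(2)[of s] w(3)[of s] by linarith
  note weighted = L1_functions_bounded_weight[OF w(1) abs_w]
  note int = L1_functions_integrable_norm[OF f] L1_functions_integrable_norm[OF weighted[OF f]]
    L1_functions_integrable_norm[OF weighted[OF g]]
    L1_functions_integrable_norm[OF L1_functions_add[OF f g]]
    L1_functions_integrable_norm[OF L1_functions_add[OF weighted[OF f] weighted[OF g]]]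
  have pointwise: "norm (f s + g s) - norm (f s)
      \<le> norm (w s *\<^sub>R f s + w s *\<^sub>R g s) - norm (w s *\<^sub>R f s) + \<epsilon> * norm (w s *\<^sub>R g s)" for s
  proof -
    have "norm (f s) - norm (f s + g s) \<le> norm (g s)"
      using norm_triangle_ineq4[of "f s + g s" "g s"] by simp
    then have "(w s - 1) * (norm (f s) - norm (f s + g s)) \<le> (w s - 1) * norm (g s)"
      using w(2)[of s] by (intro mult_left_mono) auto
    also have "\<dots> \<le> \<epsilon> * norm (w s *\<^sub>R g s)"
    proof -
      have "w s - 1 \<le> \<epsilon>" "1 \<le> w s" "0 \<le> \<epsilon>"
        using w(2)[of s] w(3)[of s] by auto
      then have "w s - 1 \<le> \<epsilon> * w s"
        using mult_left_mono[of 1 "w s" \<epsilon>] by linarith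
      then show ?thesis
        using mult_right_mono[of "w s - 1" "\<epsilon> * w s" "norm (g s)"] \<open>1 \<le> w s\<close> by (simp add: mult.assoc)
    qed
    finally have "(w s - 1) * (norm (f s) - norm (f s + g s)) \<le> \<epsilon> * norm (w s *\<^sub>R g s)" .
    moreover have "norm (w s *\<^sub>R f s + w s *\<^sub>R g s) = w s * norm (f s + g s)"
      using w(2)[of s] by (simp flip: scaleR_add_right)
    moreover have "norm (w s *\<^sub>R f s) = w s * norm (f s)"
      using w(2)[of s] by simp
    ultimately show ?thesis by (simp add: algebra_simps del: norm_scaleR)
  qed
  have "0 \<le> (LINT s|M. norm (f s + g s) - norm (f s))"
    using le int by simp
  also have "\<dots> \<le> (LINT s|M. norm (w s *\<^sub>R f s + w s *\<^sub>R g s) - norm (w s *\<^sub>R f s)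
                      + \<epsilon> * norm (w s *\<^sub>R g s))"
    using int by (intro integral_mono pointwise) (auto simp del: norm_scaleR)
  also have "\<dots> = (LINT s|M. norm (w s *\<^sub>R f s + w s *\<^sub>R g s)) - (LINT s|M. norm (w s *\<^sub>R f s))
                    + \<epsilon> * (LINT s|M. norm (w s *\<^sub>R g s))"
    using int by (simp del: norm_scaleR)
  finally show ?thesis by simp
qed

text \<open>
  If the left-hand side \<open>a - \<epsilon> b\<close> of the hypothesis is negative, squaring fails, but then the
  claimed lower bound \<open>a (a - 2 \<epsilon> b)\<close> is not positive.
\<close>

lemma squared_lower_bound:
  fixes a b c \<epsilon> :: real
  assumes "a - \<epsilon> * b \<le> c" "0 \<le> a" "0 \<le> b" "0 \<le> \<epsilon>"
  shows "a\<^sup>2 - 2 * \<epsilon> * a * b \<le> c\<^sup>2"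
proof (cases "\<epsilon> * b \<le> a")
  case True
  have "a\<^sup>2 - 2 * \<epsilon> * a * b \<le> (a - \<epsilon> * b)\<^sup>2"
    by (simp add: power2_diff)
  also have "\<dots> \<le> c\<^sup>2"
    using True assms(1) by (intro power_mono) auto
  finally show ?thesis .
next
  case False
  then have "a \<le> 2 * (\<epsilon> * b)"
    using assms by linarith
  then have "a * (a - 2 * (\<epsilon> * b)) \<le> 0"
    using assms by (intro mult_nonneg_nonpos) auto
  then have "a\<^sup>2 - 2 * \<epsilon> * a * b \<le> 0"
    by (simp add: power2_eq_square algebra_simps)
  also have "0 \<le> c\<^sup>2" by simp
  finally show ?thesis .
qed

text \<open>
  As for the operations of \<open>L1_space\<close>, the union runs over sets that coincide for all representatives
  when \<open>w\<close> is bounded and simple.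
\<close>

definition L1_multiplication ::
    "'s measure \<Rightarrow> ('s \<Rightarrow> real) \<Rightarrow> ('s \<Rightarrow> 'x::real_normed_vector) set \<Rightarrow> ('s \<Rightarrow> 'x) set" where
  "L1_multiplication M w F = (\<Union>f\<in>F. L1_class M (\<lambda>s. w s *\<^sub>R f s))"

lemma (in complete_measure) bounded_linear_L1_multiplication:
  assumes w: "simple_function M w" and bound: "\<And>s. \<bar>w s\<bar> \<le> K"
  shows "bounded_linear_operator (L1_space M :: ('a \<Rightarrow> 'x::real_normed_vector) set normed_structure)
           (L1_multiplication M w)"
proof -
  note weighted = L1_functions_bounded_weight[OF w bound]
  have mult: "L1_multiplication M w (L1_class M f) = L1_class M (\<lambda>s. w s *\<^sub>R f s)"
    if "f \<in> L1_functions M" for f :: "'a \<Rightarrow> 'x"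
    using UN_L1_class_bounded_weight[OF w bound that] by (simp add: L1_multiplication_def)
  have norm_le: "(LINT s|M. norm (w s *\<^sub>R f s)) \<le> K * (LINT s|M. norm (f s))"
    if f: "f \<in> L1_functions M" for f :: "'a \<Rightarrow> 'x"
  proof -
    have "(LINT s|M. norm (w s *\<^sub>R f s)) \<le> (LINT s|M. K * norm (f s))"
      using L1_functions_integrable_norm[OF weighted[OF f]] L1_functions_integrable_norm[OF f]
      by (intro integral_mono) (auto intro: mult_right_mono bound)
    then show ?thesis by simp
  qed
  show ?thesis
    unfolding bounded_linear_operator_def
    by (intro conjI ballI allI exI[of _ K]; (elim L1_carrierE; clarify)+)
      (simp_all add: mult weighted L1_space_add_class L1_space_scale_class L1_space_norm_class
        L1_class_in_carrier L1_functions_add L1_functions_scale norm_le scaleR_add_right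
        mult.commute del: norm_scaleR)
qed

lemma (in complete_measure) approx_BJ_orthogonal_L1_multiplication:
  fixes F G :: "('a \<Rightarrow> 'x::real_normed_vector) set"
  assumes w: "simple_function M w" "\<And>s. 1 \<le> w s" "\<And>s. w s \<le> 1 + \<epsilon>" and \<epsilon>: "0 \<le> \<epsilon>"
    and F: "F \<in> ns_carrier (L1_space M)" and G: "G \<in> ns_carrier (L1_space M)"
    and orth: "BJ_orthogonal (L1_space M) F G"
  shows "approx_BJ_orthogonal \<epsilon> (L1_space M) (L1_multiplication M w F) (L1_multiplication M w G)"
  unfolding approx_BJ_orthogonal_def
proof
  fix \<alpha> :: real
  obtain f where f: "f \<in> L1_functions M" and F_eq: "F = L1_class M f"
    using F by (rule L1_carrierE)
  obtain g where g: "g \<in> L1_functions M" and G_eq: "G = L1_class M g"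
    using G by (rule L1_carrierE)
  have abs_w: "\<bar>w s\<bar> \<le> 1 + \<epsilon>" for s
    using w(2)[of s] w(3)[of s] by linarith
  note weighted = L1_functions_bounded_weight[OF w(1) abs_w]
  note mult = UN_L1_class_bounded_weight[OF w(1) abs_w, folded L1_multiplication_def]
  note \<alpha>g = L1_functions_scale[OF g, of \<alpha>]
  note operations = L1_space_add_class L1_space_scale_class L1_space_norm_class
    L1_functions_add L1_functions_scale weighted mult f g
  have "ns_norm (L1_space M) F
      \<le> ns_norm (L1_space M) (ns_add (L1_space M) F (ns_scale (L1_space M) \<alpha> G))"
    using orth by (simp add: BJ_orthogonal_def)
  then have "(LINT s|M. norm (f s)) \<le> (LINT s|M. norm (f s + \<alpha> *\<^sub>R g s))"
    unfolding F_eq G_eq by (simp add: operations del: norm_scaleR)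
  then have "(LINT s|M. norm (w s *\<^sub>R f s)) - \<epsilon> * (LINT s|M. norm (w s *\<^sub>R \<alpha> *\<^sub>R g s))
      \<le> (LINT s|M. norm (w s *\<^sub>R f s + w s *\<^sub>R \<alpha> *\<^sub>R g s))"
    by (rule weighted_norm_integral_lower_bound[OF w f \<alpha>g])
  then have "(LINT s|M. norm (w s *\<^sub>R f s))\<^sup>2
        - 2 * \<epsilon> * (LINT s|M. norm (w s *\<^sub>R f s)) * (LINT s|M. norm (w s *\<^sub>R \<alpha> *\<^sub>R g s))
      \<le> (LINT s|M. norm (w s *\<^sub>R f s + w s *\<^sub>R \<alpha> *\<^sub>R g s))\<^sup>2"
    using \<epsilon> by (intro squared_lower_bound) (auto simp del: norm_scaleR)
  moreover have "w s *\<^sub>R \<alpha> *\<^sub>R g s = \<alpha> *\<^sub>R w s *\<^sub>R g s" for s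
    by (rule scaleR_left_commute)
  ultimately show "(ns_norm (L1_space M) (L1_multiplication M w F))\<^sup>2
      - 2 * \<epsilon> * ns_norm (L1_space M) (L1_multiplication M w F)
          * ns_norm (L1_space M) (ns_scale (L1_space M) \<alpha> (L1_multiplication M w G))
      \<le> (ns_norm (L1_space M) (ns_add (L1_space M) (L1_multiplication M w F)
             (ns_scale (L1_space M) \<alpha> (L1_multiplication M w G))))\<^sup>2"
    unfolding F_eq G_eq by (simp add: operations del: norm_scaleR scaleR_scaleR)
qed

theorem theorem3p4:
  fixes M :: "'s measure"
  assumes "sigma_finite_measure M" and "complete_measure M"
    and "\<exists>A\<in>sets M. \<exists>B\<in>sets M. A \<inter> B = {} \<and>
           0 < emeasure M A \<and> emeasure M A < \<infinity> \<and> 0 < emeasure M B \<and> emeasure M B < \<infinity>"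
    and "\<exists>x :: 'x::banach. x \<noteq> 0"
    and "wide_RNP M TYPE('x \<Rightarrow>\<^sub>L real)"
  shows "\<not> property_P (L1_space M :: ('s \<Rightarrow> 'x) set normed_structure)"
proof
  interpret complete_measure M by fact
  let ?L = "L1_space M :: ('s \<Rightarrow> 'x) set normed_structure"
  assume "property_P ?L"
  then obtain \<epsilon> where \<epsilon>: "0 < \<epsilon>"
    and P: "\<forall>T. bounded_linear_operator ?L T \<and>
        (\<forall>F\<in>ns_carrier ?L. \<forall>G\<in>ns_carrier ?L.
           BJ_orthogonal ?L F G \<longrightarrow> approx_BJ_orthogonal \<epsilon> ?L (T F) (T G)) \<longrightarrow>
        (\<exists>c\<ge>0. \<forall>F\<in>ns_carrier ?L. ns_norm ?L (T F) = c * ns_norm ?L F)"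
    unfolding property_P_def by (elim exE conjE)
  obtain A B where A: "A \<in> sets M" "0 < emeasure M A" "emeasure M A < \<infinity>"
    and B: "B \<in> sets M" "0 < emeasure M B" "emeasure M B < \<infinity>" and disj: "A \<inter> B = {}"
    using assms(3) by blast
  obtain x :: 'x where x: "x \<noteq> 0"
    using assms(4) by blast
  define w :: "'s \<Rightarrow> real" where "w s = 1 + \<epsilon> * indicator A s" for s
  have "simple_function M w"
    unfolding w_def by (rule simple_function_compose1[OF simple_function_indicator[OF A(1)]])
  moreover have "1 \<le> w s" "w s \<le> 1 + \<epsilon>" for s
    using \<epsilon> by (auto simp: w_def split: split_indicator)
  ultimately have w: "simple_function M w" "\<And>s. 1 \<le> w s" "\<And>s. w s \<le> 1 + \<epsilon>"
    by simp_all
  have abs_w: "\<bar>w s\<bar> \<le> 1 + \<epsilon>" for s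
    using w(2)[of s] w(3)[of s] by linarith
  have "\<exists>c\<ge>0. \<forall>F\<in>ns_carrier ?L. ns_norm ?L (L1_multiplication M w F) = c * ns_norm ?L F"
    using bounded_linear_L1_multiplication[OF w(1) abs_w]
      approx_BJ_orthogonal_L1_multiplication[OF w less_imp_le[OF \<epsilon>]]
    by (intro P[rule_format] conjI ballI impI)
  then obtain c where c: "\<And>F. F \<in> ns_carrier ?L \<Longrightarrow>
      ns_norm ?L (L1_multiplication M w F) = c * ns_norm ?L F"
    by (elim exE conjE) (rule that, drule bspec)
  \<comment> \<open>Testing on \<open>x\<close> times the indicator of \<open>E\<close> shows that a value of \<open>w\<close> on all of \<open>E\<close> must be \<open>c\<close>.\<close>
  have factor: "d = c"
    if E: "E \<in> sets M" "0 < emeasure M E" "emeasure M E < \<infinity>"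
      and d: "\<And>s. s \<in> E \<Longrightarrow> w s = d" "0 \<le> d" for E d
  proof -
    let ?f = "\<lambda>s. indicator E s *\<^sub>R x"
    have f: "?f \<in> L1_functions M"
      using E by (intro L1_functions_indicator)
    have norm_f: "(LINT s|M. norm (?f s)) = measure M E * norm x"
      using E by simp
    have "(LINT s|M. norm (w s *\<^sub>R ?f s)) = (LINT s|M. d * norm (?f s))"
      using d by (intro Bochner_Integration.integral_cong) (auto split: split_indicator)
    also have "\<dots> = d * (measure M E * norm x)"
      using norm_f by simp
    finally have "d * (measure M E * norm x) = c * (measure M E * norm x)"
      using c[OF L1_class_in_carrier[OF f]] norm_f
      by (simp add: L1_multiplication_def UN_L1_class_bounded_weight[OF w(1) abs_w]
          L1_space_norm_class L1_functions_bounded_weight[OF w(1) abs_w] f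
          del: norm_scaleR scaleR_scaleR mult_cancel_right)
    moreover have "measure M E \<noteq> 0"
      using E by (auto simp: measure_def enn2real_eq_0_iff)
    ultimately show ?thesis using x by simp
  qed
  have "1 + \<epsilon> = c"
    using \<epsilon> by (intro factor[OF A]) (auto simp: w_def)
  moreover have "1 = c"
    using disj by (intro factor[OF B]) (auto simp: w_def indicator_def)
  ultimately show False using \<epsilon> by simp
qed

end
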